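(* Let $(\boldsymbol V,\Phi)$ be an admissible primitive lattice substitution system. If there is an $a\in L$ such that $\Psi_0[a]$ is a singleton set, then $\boldsymbol V$ consists of model sets, i.e. each $V_i$ is a model set.
   Context: A matrix function system (MFS) is an $m\times m$ matrix $\Phi=(\Phi_{ij})$ whose entries are finite (possibly empty) sets of maps $x\mapsto Qx+a_{ijk}$ on $\mathbb R^d$, where $Q$ is one fixed expansive linear map (all eigenvalues of modulus $>1$) and $a_{ijk}\in\mathbb R^d$. It is primitive if its substitution matrix $S(\Phi)=(\#\Phi_{ij})_{i,j}$ is primitive, i.e. some power has only strictly positive entries. Powers are defined by composition: $(\Phi^{k+1})_{ij}=\bigcup_{\ell}\{g\circ f : g\in(\Phi^k)_{i\ell},\ f\in\Phi_{\ell j}\}$. For $\boldsymbol V=(V_1,\dots,V_m)^T$ with $V_i\subset\mathbb R^d$, $\Phi\boldsymbol V=(W_1,\dots,W_m)$ with $W_i=\bigcup_j\bigcup_{f\in\Phi_{ij}}f(V_j)$. A lattice substitution system (LSS) with $m$ components is a pair $(\boldsymbol V,\Phi)$ with $\Phi\boldsymbol V=\boldsymbol V$, the $V_i$ mutually disjoint, the unions $V_i=\bigcup_{j}\bigcup_{f\in\Phi_{ij}}f(V_j)$ pairwise disjoint for every $i$, and $L:=\operatorname{supp}(\boldsymbol V)=\bigcup_iV_i$ a lattice in $\mathbb R^d$. It is primitive if $\Phi$ is. Standing assumption: for every $r>0$, every $r$-cluster $(V_1\cap(x+r\mathbb B^d),\dots,V_m\cap(x+r\mathbb B^d))$ of $\boldsymbol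 V$ ($\mathbb B^d$ the closed unit ball) is, up to translation, contained in $\Phi^k(\boldsymbol v)$ for some $k\in\mathbb N$ and some single point $\boldsymbol v$ of some type $i$ (a vector of sets whose $i$-th entry is a one-point set, all others being empty). A primitive LSS is admissible if the translational parts of all maps in $\Phi$ belong to one fixed system of representatives (containing $0$) in $L$ of $L/QL$. Put $L_i=\langle V_i-V_i\rangle_{\mathbb Z}$, $L'=L_1+\dots+L_m$, and for $a\in L$ let $\Psi_0[a]=\{i : (a+L')\cap V_i\ne\varnothing\}\subset\{1,\dots,m\}$. Model sets: a cut and project scheme consists of a locally compact Abelian group $H$ and a lattice $\tilde L\subset\mathbb R^d\times H$ (discrete subgroup with compact quotient) such that the canonical projection $\pi:\mathbb R^d\times H\to\mathbb R^d$ is injective on $\tilde L$ and the canonical projection $\pi_{\rm int}:\mathbb R^d\times H\to H$ maps $\tilde L$ onto a dense subset of $H$. A model set in $\mathbb R^d$ is a set which, up to translation, has the form $\Lambda(\Omega)=\{\pi(x) : x\in\tilde L,\ \pi_{\rm int}(x)\in\Omega\}$ for some cut and project scheme, where $\Omega\subset H$ has nonempty interior and compact closure. *)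

theory Defs
  imports
    "HOL-Analysis.Analysis"
    "HOL-Algebra.Coset"
    "HOL-Computational_Algebra.Group_Closure"
begin

section \<open>Matrix function systems\<close>

text \<open>The component indices \<open>1, \<dots>, m\<close> form a finite type \<open>'m\<close>.\<close>

type_synonym ('m, 'd) mfs = "'m \<Rightarrow> 'm \<Rightarrow> ((real^'d) \<Rightarrow> (real^'d)) set"

definition complex_eigenvalue :: "real^'d^'d \<Rightarrow> complex \<Rightarrow> bool" where
  "complex_eigenvalue A c \<longleftrightarrow>
     (\<exists>v :: complex^'d. v \<noteq> 0 \<and> (\<chi> i j. complex_of_real (A $ i $ j)) *v v = c *s v)"

definition expansive :: "(real^'d \<Rightarrow> real^'d) \<Rightarrow> bool" where
  "expansive Q \<longleftrightarrow> linear Q \<and> (\<forall>c. complex_eigenvalue (matrix Q) c \<longrightarrow> 1 < cmod c)"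

definition is_mfs :: "(real^'d \<Rightarrow> real^'d) \<Rightarrow> ('m, 'd) mfs \<Rightarrow> bool" where
  "is_mfs Q \<Phi> \<longleftrightarrow> expansive Q \<and>
     (\<forall>i j. finite (\<Phi> i j) \<and> (\<forall>f \<in> \<Phi> i j. \<exists>a. f = (\<lambda>x. Q x + a)))"

definition subst_matrix :: "('m::finite, 'd) mfs \<Rightarrow> nat^'m^'m" where
  "subst_matrix \<Phi> = (\<chi> i j. card (\<Phi> i j))"

text \<open>The matrix power is written as an iterated product, since \<open>*\<close> and \<open>^\<close> on vectors
  act componentwise. The exponent is positive.\<close>

definition primitive_matrix :: "nat^'m^'m \<Rightarrow> bool" where
  "primitive_matrix S \<longleftrightarrow> (\<exists>k \<ge> 1. \<forall>i j. 0 < (((**) S ^^ k) (mat 1)) $ i $ j)"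

definition primitive_mfs :: "('m::finite, 'd) mfs \<Rightarrow> bool" where
  "primitive_mfs \<Phi> \<longleftrightarrow> primitive_matrix (subst_matrix \<Phi>)"

primrec mfs_power :: "('m, 'd) mfs \<Rightarrow> nat \<Rightarrow> ('m, 'd) mfs" where
  "mfs_power \<Phi> 0 = (\<lambda>i j. if i = j then {id} else {})"
| "mfs_power \<Phi> (Suc k) = (\<lambda>i j. \<Union>l. {g \<circ> f |g f. g \<in> mfs_power \<Phi> k i l \<and> f \<in> \<Phi> l j})"

definition mfs_apply :: "('m, 'd) mfs \<Rightarrow> ('m \<Rightarrow> (real^'d) set) \<Rightarrow> 'm \<Rightarrow> (real^'d) set" where
  "mfs_apply \<Phi> V = (\<lambda>i. \<Union>j. \<Union>f \<in> \<Phi> i j. f ` V j)"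


section \<open>Lattices in topological groups\<close>

definition topological_group :: "('g, 'b) monoid_scheme \<Rightarrow> 'g topology \<Rightarrow> bool" where
  "topological_group G X \<longleftrightarrow> group G \<and> topspace X = carrier G \<and>
     continuous_map (prod_topology X X) X (\<lambda>(x, y). x \<otimes>\<^bsub>G\<^esub> y) \<and>
     continuous_map X X (\<lambda>x. inv\<^bsub>G\<^esub> x)"

text \<open>As usual, locally compact groups are understood to be Hausdorff.\<close>

definition lca_group :: "('g, 'b) monoid_scheme \<Rightarrow> 'g topology \<Rightarrow> bool" where
  "lca_group G X \<longleftrightarrow> comm_group G \<and> topological_group G X \<and>
     Hausdorff_space X \<and> locally_compact_space X"

text \<open>A lattice is a discrete subgroup with compact quotient. The quotient space \<open>Y\<close> below is
  unique: its points are the cosets and its topology is the quotient topology.\<close>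

definition lattice_in :: "('g, 'b) monoid_scheme \<Rightarrow> 'g topology \<Rightarrow> 'g set \<Rightarrow> bool" where
  "lattice_in G X S \<longleftrightarrow> subgroup S G \<and> subtopology X S = discrete_topology S \<and>
     (\<exists>Y. quotient_map X Y (\<lambda>x. S #>\<^bsub>G\<^esub> x) \<and> compact_space Y)"

definition vec_group :: "(real^'d) monoid" where
  "vec_group = \<lparr>carrier = UNIV, mult = (+), one = 0\<rparr>"


section \<open>Lattice substitution systems\<close>

definition supp :: "('m \<Rightarrow> (real^'d) set) \<Rightarrow> (real^'d) set" where
  "supp V = (\<Union>i. V i)"

definition is_lss ::
  "(real^'d \<Rightarrow> real^'d) \<Rightarrow> ('m \<Rightarrow> (real^'d) set) \<Rightarrow> ('m::finite, 'd) mfs \<Rightarrow> bool" where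
  "is_lss Q V \<Phi> \<longleftrightarrow> is_mfs Q \<Phi> \<and> mfs_apply \<Phi> V = V \<and> disjoint_family V \<and>
     (\<forall>i. disjoint_family_on (\<lambda>(j, f). f ` V j) (SIGMA j:UNIV. \<Phi> i j)) \<and>
     lattice_in vec_group euclidean (supp V)"

definition single_point :: "'m \<Rightarrow> real^'d \<Rightarrow> 'm \<Rightarrow> (real^'d) set" where
  "single_point i p = (\<lambda>j. if j = i then {p} else {})"

text \<open>The standing assumption: every \<open>r\<close>-cluster occurs, up to translation, in some
  \<open>\<Phi>\<^sup>k\<close> applied to a single point.\<close>

definition clusters_generated :: "('m \<Rightarrow> (real^'d) set) \<Rightarrow> ('m, 'd) mfs \<Rightarrow> bool" where
  "clusters_generated V \<Phi> \<longleftrightarrow>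
     (\<forall>r > 0. \<forall>x. \<exists>k i p t. \<forall>j.
        (\<lambda>y. t + y) ` (V j \<inter> cball x r) \<subseteq> mfs_apply (mfs_power \<Phi> k) (single_point i p) j)"

definition representatives :: "(real^'d \<Rightarrow> real^'d) \<Rightarrow> (real^'d) set \<Rightarrow> (real^'d) set \<Rightarrow> bool" where
  "representatives Q L D \<longleftrightarrow> D \<subseteq> L \<and> (\<forall>x \<in> L. \<exists>!d. d \<in> D \<and> x - d \<in> Q ` L)"

text \<open>\<open>Q L \<subseteq> L\<close> is not listed: for a primitive LSS it follows from the translational parts
  being in \<open>L\<close>, because each \<open>V j\<close> is mapped into \<open>L\<close> by some map of \<open>\<Phi>\<close>.\<close>

definition admissible ::
  "(real^'d \<Rightarrow> real^'d) \<Rightarrow> ('m \<Rightarrow> (real^'d) set) \<Rightarrow> ('m, 'd) mfs \<Rightarrow> bool" where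
  "admissible Q V \<Phi> \<longleftrightarrow>
     (\<exists>D. representatives Q (supp V) D \<and> 0 \<in> D \<and>
          (\<forall>i j a. (\<lambda>x. Q x + a) \<in> \<Phi> i j \<longrightarrow> a \<in> D))"

definition L_comp :: "('m \<Rightarrow> (real^'d) set) \<Rightarrow> 'm \<Rightarrow> (real^'d) set" where
  "L_comp V i = group_closure {x - y |x y. x \<in> V i \<and> y \<in> V i}"

definition L_sum :: "('m::finite \<Rightarrow> (real^'d) set) \<Rightarrow> (real^'d) set" where
  "L_sum V = {(\<Sum>i\<in>UNIV. g i) |g. \<forall>i. g i \<in> L_comp V i}"

definition Psi0 :: "('m::finite \<Rightarrow> (real^'d) set) \<Rightarrow> real^'d \<Rightarrow> 'm set" where
  "Psi0 V a = {i. (\<lambda>y. a + y) ` L_sum V \<inter> V i \<noteq> {}}"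


section \<open>Model sets\<close>

definition cut_and_project ::
  "'h monoid \<Rightarrow> 'h topology \<Rightarrow> ((real^'d) \<times> 'h) set \<Rightarrow> bool" where
  "cut_and_project H X Lt \<longleftrightarrow> lca_group H X \<and>
     lattice_in (vec_group \<times>\<times> H) (prod_topology euclidean X) Lt \<and>
     inj_on fst Lt \<and> X closure_of (snd ` Lt) = topspace X"

definition Lambda :: "((real^'d) \<times> 'h) set \<Rightarrow> 'h set \<Rightarrow> (real^'d) set" where
  "Lambda Lt \<Omega> = {fst x |x. x \<in> Lt \<and> snd x \<in> \<Omega>}"

text \<open>HOL cannot quantify over the type of the internal group, so \<open>H\<close> is taken with carrier
  inside the type \<open>(real^'d) set set\<close>. This is no restriction: for an arbitrary cut and project
  scheme, the map sending \<open>h\<close> to the family of all \<open>A \<subseteq> \<real>\<^sup>d\<close> that contain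
  \<open>Lambda Lt U\<close> for some neighbourhood \<open>U\<close> of \<open>h\<close> is injective, since \<open>H\<close> is
  Hausdorff and the image of \<open>Lt\<close> in \<open>H\<close> is dense; so \<open>H\<close> can be
  transported to a group on a subset of that type.\<close>

definition model_set :: "(real^'d) set \<Rightarrow> bool" where
  "model_set M \<longleftrightarrow>
     (\<exists>(H :: (real^'d) set set monoid) X Lt \<Omega> t.
        cut_and_project H X Lt \<and> \<Omega> \<subseteq> carrier H \<and>
        X interior_of \<Omega> \<noteq> {} \<and> compactin X (X closure_of \<Omega>) \<and>
        M = (\<lambda>y. t + y) ` Lambda Lt \<Omega>)"

end

theory Submission
  imports Defs "HOL-Algebra.Product_Groups"
begin

text \<open>
  Write \<open>L = supp V\<close> and \<open>L' = L_sum V\<close>. If \<open>Psi0 V a = {i\<^sub>0}\<close>, then every point of the coset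
  \<open>a + L'\<close>, which lies in \<open>L\<close>, has type \<open>i\<^sub>0\<close>, so \<open>a + L' \<subseteq> V i\<^sub>0\<close>. By primitivity every \<open>V i\<close>
  contains an image of \<open>V i\<^sub>0\<close> under some map \<open>x \<mapsto> Q\<^sup>k x + b\<close>, hence a coset of \<open>Q\<^sup>k L'\<close>.
  Moreover \<open>L\<close> is covered by finitely many cosets of \<open>L'\<close> (one for each type) and by finitely many
  cosets of \<open>Q L\<close> (one for each map of \<open>\<Phi>\<close>). By the pigeonhole principle
  (\<open>multiple_in_subgroup_if_finite_cosets\<close>) both groups contain a multiple \<open>n L\<close>. Therefore every
  \<open>V i\<close> contains a coset \<open>b + n L\<close> with \<open>n > 0\<close>.

  It remains to see that every subset \<open>S\<close> of a lattice \<open>L\<close> that contains such a coset is a model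
  set (\<open>model_set_if_contains_coset\<close>). Embed \<open>L\<close> by \<open>\<iota>\<close> into the compact group
  \<open>\<Prod>\<^sub>n L / n L\<close>, and let \<open>H\<close> be the closure of the image, the profinite completion of \<open>L\<close>. As \<open>H\<close> is
  compact, the graph of \<open>\<iota>\<close> is a lattice in \<open>\<real>\<^sup>d \<times> H\<close>. The elements of \<open>H\<close> whose component at \<open>n\<close>
  is \<open>b + n L\<close> form an open set \<open>W\<close>, and \<open>\<iota> x \<in> W\<close> only for \<open>x \<in> b + n L \<subseteq> S\<close>. Since \<open>\<iota>\<close> is
  injective, the window \<open>\<iota> ` S \<union> W\<close> selects exactly \<open>S\<close>, and it has interior points because of \<open>W\<close>.

  The definition of a model set fixes the type of the internal group. The completion is moved to
  that type by the map that sends \<open>h\<close> to the traces on \<open>L\<close> of its neighbourhoods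
  (\<open>inj_on_neighbourhood_traces\<close>, \<open>lca_group_copy\<close>).
\<close>

section \<open>Topological groups\<close>

lemma topological_group_discrete:
  assumes "group G"
  shows "topological_group G (discrete_topology (carrier G))"
proof -
  interpret group G by fact
  show ?thesis
    unfolding topological_group_def
    by (auto simp: assms Pi_iff simp flip: prod_topology_discrete_topology)
qed

lemma topological_group_product:
  assumes G: "\<And>i. i \<in> I \<Longrightarrow> topological_group (G i) (X i)"
  shows "topological_group (product_group I G) (product_topology X I)"
proof -
  let ?P = "product_topology X I"
  have grp: "group (G i)" and car: "topspace (X i) = carrier (G i)" if "i \<in> I" for i
    using G[OF that] by (auto simp: topological_group_def)
  have top: "topspace ?P = carrier (product_group I G)"
    by (auto simp: car PiE_iff)
  have proj: "continuous_map ?P (X i) (\<lambda>x. x i)" if "i \<in> I" for i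
    using that by (rule continuous_map_product_projection)
  have "continuous_map (prod_topology ?P ?P) (X i) (\<lambda>p. fst p i \<otimes>\<^bsub>G i\<^esub> snd p i)" if "i \<in> I" for i
  proof -
    have "continuous_map (prod_topology ?P ?P) (prod_topology (X i) (X i)) (\<lambda>p. (fst p i, snd p i))"
      by (intro continuous_map_pairedI continuous_map_compose[OF continuous_map_fst proj[OF that], unfolded o_def]
            continuous_map_compose[OF continuous_map_snd proj[OF that], unfolded o_def])
    moreover have "continuous_map (prod_topology (X i) (X i)) (X i) (\<lambda>(x, y). x \<otimes>\<^bsub>G i\<^esub> y)"
      using G[OF that] by (simp add: topological_group_def)
    ultimately show ?thesis
      by (rule continuous_map_compose[unfolded o_def, THEN continuous_map_eq]) auto
  qed
  then have mult: "continuous_map (prod_topology ?P ?P) ?P (\<lambda>(x, y). x \<otimes>\<^bsub>product_group I G\<^esub> y)"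
    by (auto simp: continuous_map_componentwise case_prod_unfold)
  have "continuous_map ?P (X i) (\<lambda>x. inv\<^bsub>G i\<^esub> x i)" if "i \<in> I" for i
    using G[OF that] continuous_map_compose[OF proj[OF that], of "X i" "\<lambda>x. inv\<^bsub>G i\<^esub> x"]
    by (simp add: topological_group_def o_def)
  then have "continuous_map ?P ?P (\<lambda>x. \<lambda>i\<in>I. inv\<^bsub>G i\<^esub> x i)"
    by (auto simp: continuous_map_componentwise)
  then have "continuous_map ?P ?P (\<lambda>x. inv\<^bsub>product_group I G\<^esub> x)"
    by (rule continuous_map_eq) (use top grp in auto)
  with mult top grp show ?thesis
    by (simp add: topological_group_def)
qed

lemma topological_group_subgroup:
  assumes G: "topological_group G X" and H: "subgroup H G"
  shows "topological_group (G\<lparr>carrier := H\<rparr>) (subtopology X H)"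
proof -
  interpret group G using G by (simp add: topological_group_def)
  interpret H: subgroup H G by fact
  have X: "topspace X = carrier G"
    "continuous_map (prod_topology X X) X (\<lambda>(x, y). x \<otimes>\<^bsub>G\<^esub> y)"
    "continuous_map X X (\<lambda>x. inv\<^bsub>G\<^esub> x)"
    using G by (auto simp: topological_group_def)
  have "continuous_map (prod_topology (subtopology X H) (subtopology X H)) (subtopology X H)
          (\<lambda>(x, y). x \<otimes>\<^bsub>G\<^esub> y)"
    using X(2) by (auto simp: prod_topology_subtopology continuous_map_in_subtopology
      subtopology_subtopology intro: continuous_map_from_subtopology)
  moreover have "continuous_map (subtopology X H) (subtopology X H) (\<lambda>x. inv\<^bsub>G\<^esub> x)"
    using X(3) by (auto simp: continuous_map_in_subtopology intro: continuous_map_from_subtopology)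
  then have "continuous_map (subtopology X H) (subtopology X H) (\<lambda>x. inv\<^bsub>G\<lparr>carrier := H\<rparr>\<^esub> x)"
    by (rule continuous_map_eq) (use H in \<open>auto simp: m_inv_consistent\<close>)
  ultimately show ?thesis
    using X(1) H.subset H by (auto simp: topological_group_def subgroup.subgroup_is_group)
qed

text \<open>Continuity carries closures into closures, and the closure of \<open>H \<times> H\<close> is the product of the
  closures, so multiplication and inversion preserve the closure of \<open>H\<close>.\<close>

lemma subgroup_closure_of:
  assumes G: "topological_group G X" and H: "subgroup H G"
  shows "subgroup (X closure_of H) G"
proof -
  interpret group G using G by (simp add: topological_group_def)
  interpret H: subgroup H G by fact
  have X: "topspace X = carrier G"
    "continuous_map (prod_topology X X) X (\<lambda>(x, y). x \<otimes>\<^bsub>G\<^esub> y)"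
    "continuous_map X X (\<lambda>x. inv\<^bsub>G\<^esub> x)"
    using G by (auto simp: topological_group_def)
  have HH: "H \<subseteq> X closure_of H"
    by (simp add: closure_of_subset H.subset X(1))
  have m: "(\<lambda>(x, y). x \<otimes>\<^bsub>G\<^esub> y) ` ((X closure_of H) \<times> (X closure_of H)) \<subseteq> X closure_of H"
  proof -
    have "(\<lambda>(x, y). x \<otimes>\<^bsub>G\<^esub> y) ` (prod_topology X X closure_of (H \<times> H))
        \<subseteq> X closure_of ((\<lambda>(x, y). x \<otimes>\<^bsub>G\<^esub> y) ` (H \<times> H))"
      by (rule continuous_map_image_closure_subset[OF X(2)])
    also have "\<dots> \<subseteq> X closure_of H"
      by (rule closure_of_mono) auto
    finally show ?thesis by (simp add: closure_of_Times)
  qed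
  have i: "(\<lambda>x. inv\<^bsub>G\<^esub> x) ` (X closure_of H) \<subseteq> X closure_of H"
    using continuous_map_image_closure_subset[OF X(3), of H] closure_of_mono[of "(\<lambda>x. inv\<^bsub>G\<^esub> x) ` H" H X]
    by auto
  show ?thesis
  proof
    show "X closure_of H \<subseteq> carrier G"
      using closure_of_subset_topspace[of X H] X(1) by simp
    show "\<one>\<^bsub>G\<^esub> \<in> X closure_of H" using HH by auto
  qed (use m i in auto)
qed

text \<open>A locally compact Abelian group can be moved along any injective map, which makes it possible
  to realise an internal group in a prescribed type.\<close>

lemma lca_group_copy:
  fixes j :: "'a \<Rightarrow> 'b"
  assumes K: "lca_group K X" and j: "inj_on j (carrier K)"
  obtains H :: "'b monoid" and Y
    where "lca_group H Y" "j \<in> iso K H" "homeomorphic_map X Y j"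
proof -
  interpret comm_group K using K by (simp add: lca_group_def)
  define g where "g = inv_into (carrier K) j"
  have gj [simp]: "g (j x) = x" if "x \<in> carrier K" for x
    using that j by (simp add: g_def)
  define H :: "'b monoid" where
    "H = \<lparr>carrier = j ` carrier K, mult = \<lambda>a b. j (g a \<otimes>\<^bsub>K\<^esub> g b), one = j \<one>\<^bsub>K\<^esub>\<rparr>"
  have iso: "j \<in> iso K H"
    using j by (auto simp: iso_def hom_def bij_betw_def H_def)
  have "monoid H"
    by (rule monoidI) (auto simp: H_def m_assoc)
  then have H: "comm_group H"
    using iso_imp_comm_group is_isoI[OF iso] by blast
  then interpret H: comm_group H .
  have jinv: "inv\<^bsub>H\<^esub> (j x) = j (inv\<^bsub>K\<^esub> x)" if "x \<in> carrier K" for x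
    using that by (intro H.inv_equality) (auto simp: H_def)
  define Y where "Y = pullback_topology (j ` carrier K) g X"
  have X: "topspace X = carrier K"
    "continuous_map (prod_topology X X) X (\<lambda>(x, y). x \<otimes>\<^bsub>K\<^esub> y)"
    "continuous_map X X (\<lambda>x. inv\<^bsub>K\<^esub> x)"
    using K by (auto simp: lca_group_def topological_group_def)
  have Y: "topspace Y = j ` carrier K"
    by (auto simp: Y_def topspace_pullback_topology X(1))
  have cg: "continuous_map Y X g"
    unfolding Y_def using continuous_map_pullback[OF continuous_map_id] by (metis id_comp)
  have cj: "continuous_map X Y j"
    unfolding Y_def
    by (rule continuous_map_pullback') (auto simp: X(1) intro!: continuous_map_eq[OF continuous_map_id])
  have homeo: "homeomorphic_map X Y j"
    unfolding homeomorphic_map_maps homeomorphic_maps_def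
    using cg cj X(1) Y by auto
  have "continuous_map (prod_topology Y Y) (prod_topology X X) (\<lambda>p. (g (fst p), g (snd p)))"
    by (intro continuous_map_pairedI continuous_map_compose[OF continuous_map_fst cg, unfolded o_def]
          continuous_map_compose[OF continuous_map_snd cg, unfolded o_def])
  from continuous_map_compose[OF continuous_map_compose[OF this X(2)] cj]
  have "continuous_map (prod_topology Y Y) Y (\<lambda>(x, y). x \<otimes>\<^bsub>H\<^esub> y)"
    by (simp add: o_def H_def case_prod_unfold)
  moreover
  from continuous_map_compose[OF continuous_map_compose[OF cg X(3)] cj]
  have "continuous_map Y Y (\<lambda>x. inv\<^bsub>H\<^esub> x)"
    by (rule continuous_map_eq) (auto simp: Y jinv)
  ultimately have "topological_group H Y"
    using Y H.is_group by (simp add: topological_group_def H_def)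
  moreover have "X homeomorphic_space Y"
    using homeo homeomorphic_map_imp_homeomorphic_space by blast
  ultimately have "lca_group H Y"
    using K H homeomorphic_Hausdorff_space homeomorphic_locally_compact_space
    unfolding lca_group_def by blast
  with iso homeo show ?thesis using that by blast
qed

text \<open>Points of a Hausdorff space are told apart by the traces that their neighbourhoods leave on a
  dense subset: were the neighbourhood \<open>U\<close> of \<open>h\<close> to have the same trace as a neighbourhood \<open>U''\<close>
  of \<open>h'\<close>, a dense point near \<open>h'\<close> would lie in \<open>U\<close> and in a neighbourhood of \<open>h'\<close> disjoint from \<open>U\<close>.\<close>

lemma inj_on_neighbourhood_traces:
  assumes X: "Hausdorff_space X" and dense: "X closure_of (\<iota> ` L) = topspace X"
  shows "inj_on (\<lambda>h. {{x \<in> L. \<iota> x \<in> U} |U. openin X U \<and> h \<in> U}) (topspace X)"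
    (is "inj_on ?j _")
proof (rule inj_onI, rule ccontr)
  fix h h' assume h: "h \<in> topspace X" "h' \<in> topspace X" "?j h = ?j h'" "h \<noteq> h'"
  then obtain U U' where U: "openin X U" "openin X U'" "h \<in> U" "h' \<in> U'" "disjnt U U'"
    using X unfolding Hausdorff_space_def by metis
  then have "{x \<in> L. \<iota> x \<in> U} \<in> ?j h'"
    using h(3) by blast
  then obtain U'' where U'': "openin X U''" "h' \<in> U''" "{x \<in> L. \<iota> x \<in> U} = {x \<in> L. \<iota> x \<in> U''}"
    by auto
  have "h' \<in> X closure_of (\<iota> ` L)" using dense h by simp
  then obtain x where "x \<in> L" "\<iota> x \<in> U' \<inter> U''"
    using U U'' openin_Int[of X U' U''] unfolding in_closure_of by blast
  then show False using U(5) U''(3) by (auto simp: disjnt_iff)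
qed


section \<open>Lattices in Euclidean space\<close>

lemma vec_group_simps [simp]:
  "carrier vec_group = UNIV" "x \<otimes>\<^bsub>vec_group\<^esub> y = x + y" "\<one>\<^bsub>vec_group\<^esub> = 0"
  by (simp_all add: vec_group_def)

lemma comm_group_vec_group: "comm_group (vec_group :: (real^'d) monoid)"
proof (rule comm_groupI)
  show "\<exists>y\<in>carrier vec_group. y \<otimes>\<^bsub>vec_group\<^esub> x = \<one>\<^bsub>vec_group\<^esub>" for x :: "real^'d"
    by (rule bexI[of _ "- x"]) auto
qed (auto simp: algebra_simps)

lemma inv_vec_group [simp]: "inv\<^bsub>vec_group\<^esub> x = - (x :: real^'d)"
  using comm_group.axioms(2)[OF comm_group_vec_group] by (intro group.inv_equality) auto

lemma r_coset_vec_group: "S #>\<^bsub>vec_group\<^esub> x = (\<lambda>l. l + x) ` S"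
  by (auto simp: r_coset_def)

lemma subgroup_vec_group_iff:
  "subgroup S (vec_group :: (real^'d) monoid) \<longleftrightarrow> 0 \<in> S \<and> (\<forall>x\<in>S. \<forall>y\<in>S. x - y \<in> S)"
proof
  assume "0 \<in> S \<and> (\<forall>x\<in>S. \<forall>y\<in>S. x - y \<in> S)"
  then have S: "0 \<in> S" "\<And>x y. x \<in> S \<Longrightarrow> y \<in> S \<Longrightarrow> x - y \<in> S" by auto
  have neg: "- x \<in> S" if "x \<in> S" for x using S(2)[OF S(1) that] by simp
  have "x + y \<in> S" if "x \<in> S" "y \<in> S" for x y using S(2)[OF that(1) neg[OF that(2)]] by simp
  with S(1) neg show "subgroup S vec_group" by unfold_locales auto
next
  assume "subgroup S vec_group"
  then interpret S: subgroup S vec_group .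
  have "x - y \<in> S" if "x \<in> S" "y \<in> S" for x y
    using S.m_closed[OF that(1) S.m_inv_closed[OF that(2)]] by simp
  then show "0 \<in> S \<and> (\<forall>x\<in>S. \<forall>y\<in>S. x - y \<in> S)" using S.one_closed by auto
qed

lemma subgroup_scaleR_nat:
  assumes "subgroup S vec_group" "x \<in> S"
  shows "real n *\<^sub>R x \<in> S"
proof (induction n)
  case 0
  then show ?case using assms by (simp add: subgroup_vec_group_iff)
next
  case (Suc n)
  then show ?case using subgroup.m_closed[OF assms(1) Suc assms(2)] by (simp add: algebra_simps)
qed

text \<open>By homogeneity a single radius of isolation, the one at \<open>0\<close>, serves all points.\<close>

lemma lattice_discrete:
  fixes L :: "(real^'d) set"
  assumes "lattice_in vec_group euclidean L"
  obtains e where "e > 0" "\<And>x y. x \<in> L \<Longrightarrow> y \<in> L \<Longrightarrow> dist x y < e \<Longrightarrow> x = y"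
proof -
  have L: "0 \<in> L" "\<And>x y. x \<in> L \<Longrightarrow> y \<in> L \<Longrightarrow> x - y \<in> L"
    and "top_of_set L = discrete_topology L"
    using assms by (auto simp: lattice_in_def subgroup_vec_group_iff)
  then have "openin (top_of_set L) {0}" by simp
  then obtain e where e: "e > 0" "ball 0 e \<inter> L \<subseteq> {0}"
    by (auto simp: openin_contains_ball)
  have "x = y" if "x \<in> L" "y \<in> L" "dist x y < e" for x y
    using L(2)[OF that(1,2)] e(2) that(3) by (auto simp: dist_norm)
  with e(1) show ?thesis using that by blast
qed

text \<open>The images of the balls \<open>ball 0 n\<close> are open in the quotient and increase to all of it, so by
  compactness one of them is the whole quotient.\<close>

lemma lattice_cocompact:
  fixes L :: "(real^'d) set"
  assumes "lattice_in vec_group euclidean L"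
  obtains R where "R > 0" "\<And>x. \<exists>l\<in>L. norm (x - l) \<le> R"
proof -
  have L: "0 \<in> L" "\<And>x y. x \<in> L \<Longrightarrow> y \<in> L \<Longrightarrow> x - y \<in> L"
    using assms by (auto simp: lattice_in_def subgroup_vec_group_iff)
  let ?q = "\<lambda>x. L #>\<^bsub>vec_group\<^esub> x"
  have q: "?q x = ?q y \<longleftrightarrow> x - y \<in> L" for x y
  proof
    assume "?q x = ?q y"
    then have "x \<in> (\<lambda>l. l + y) ` L" using L(1) by (force simp: r_coset_vec_group)
    then show "x - y \<in> L" by auto
  next
    assume xy: "x - y \<in> L"
    have *: "l + (x - y) \<in> L" "l - (x - y) \<in> L" if "l \<in> L" for l
    proof -
      have "l + (x - y) = l - (0 - (x - y))" by simp
      also have "\<dots> \<in> L" using L(2)[OF that L(2)[OF L(1) xy]] .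
      finally show "l + (x - y) \<in> L" .
      show "l - (x - y) \<in> L" using L(2)[OF that xy] .
    qed
    show "?q x = ?q y"
      unfolding r_coset_vec_group
    proof (intro subset_antisym image_subsetI)
      show "l + x \<in> (\<lambda>l. l + y) ` L" if "l \<in> L" for l
        using *(1)[OF that] by (intro image_eqI[of _ _ "l + (x - y)"]) auto
      show "l + y \<in> (\<lambda>l. l + x) ` L" if "l \<in> L" for l
        using *(2)[OF that] by (intro image_eqI[of _ _ "l - (x - y)"]) auto
    qed
  qed
  obtain Y where Y: "quotient_map euclidean Y ?q" "compact_space Y"
    using assms by (auto simp: lattice_in_def)
  have surj: "topspace Y = range ?q"
    using Y(1) by (simp add: quotient_map_def)
  have op: "openin Y (?q ` ball 0 r)" for r
  proof -
    have "{x. ?q x \<in> ?q ` ball 0 r} = (\<Union>l\<in>L. (\<lambda>x. l + x) ` ball 0 r)"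
    proof (intro subset_antisym subsetI)
      fix x assume "x \<in> {x. ?q x \<in> ?q ` ball 0 r}"
      then obtain c where c: "c \<in> ball 0 r" "x - c \<in> L" by (auto simp: q)
      have "x = (x - c) + c" by simp
      then show "x \<in> (\<Union>l\<in>L. (\<lambda>x. l + x) ` ball 0 r)" using c by blast
    next
      fix x assume "x \<in> (\<Union>l\<in>L. (\<lambda>x. l + x) ` ball 0 r)"
      then obtain l c where c: "l \<in> L" "c \<in> ball 0 r" "x = l + c" by blast
      then have "?q x = ?q c" by (simp add: q)
      then show "x \<in> {x. ?q x \<in> ?q ` ball 0 r}" using c(2) by blast
    qed
    then have "open {x. ?q x \<in> ?q ` ball 0 r}" by (auto intro: open_translation)
    moreover have "?q ` ball 0 r \<subseteq> topspace Y"
      using surj by blast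
    ultimately show ?thesis using Y(1) by (simp add: quotient_map_def)
  qed
  have cover: "topspace Y \<subseteq> \<Union>(range (\<lambda>n. ?q ` ball 0 (real n)))"
  proof
    fix y assume "y \<in> topspace Y"
    then obtain x where x: "y = ?q x" using surj by blast
    obtain n where "norm x < real n" using reals_Archimedean2 by blast
    then have "x \<in> ball 0 (real n)" by simp
    then show "y \<in> \<Union>(range (\<lambda>n. ?q ` ball 0 (real n)))" using x by blast
  qed
  have opens: "\<forall>U\<in>range (\<lambda>n. ?q ` ball 0 (real n)). openin Y U"
    using op by blast
  have "\<exists>F. finite F \<and> F \<subseteq> range (\<lambda>n. ?q ` ball 0 (real n)) \<and> topspace Y \<subseteq> \<Union>F"
    by (rule Y(2)[unfolded compact_space_alt, rule_format, OF conjI[OF opens cover]])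
  then obtain F where F: "finite F" "F \<subseteq> range (\<lambda>n. ?q ` ball 0 (real n))" "topspace Y \<subseteq> \<Union>F"
    by (elim exE conjE)
  then obtain N where N: "finite N" "F = (\<lambda>n. ?q ` ball 0 (real n)) ` N"
    by (meson finite_subset_image)
  define R where "R = real (Suc (Max (insert 0 N)))"
  have "\<exists>l\<in>L. norm (x - l) \<le> R" for x
  proof -
    have "?q x \<in> \<Union>F" using F(3) surj by blast
    then obtain n c where n: "n \<in> N" "norm c < real n" "?q x = ?q c"
      using N(2) by auto
    have "n \<le> Max (insert 0 N)" using n(1) N(1) by simp
    then have "norm c \<le> R" using n(2) by (simp add: R_def)
    then show ?thesis using n(3) by (intro bexI[of _ "x - c"]) (auto simp: q)
  qed
  moreover have "R > 0" by (simp add: R_def)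
  ultimately show ?thesis using that by blast
qed

lemma lattice_finite_cball:
  fixes L :: "(real^'d) set"
  assumes "lattice_in vec_group euclidean L"
  shows "finite (L \<inter> cball 0 r)"
proof -
  obtain e where "e > 0" "\<And>x y. x \<in> L \<Longrightarrow> y \<in> L \<Longrightarrow> dist x y < e \<Longrightarrow> x = y"
    by (rule lattice_discrete[OF assms]) blast
  then have "uniform_discrete (L \<inter> cball 0 r)"
    unfolding uniform_discrete_def by (intro exI[of _ e]) auto
  then show ?thesis
    by (meson uniform_discrete_finite_iff bounded_Int bounded_cball)
qed

section \<open>Cut and project schemes with compact internal group\<close>

lemma quotient_topology_exists:
  obtains Y where "quotient_map X Y f"
proof -
  define opn where "opn U \<longleftrightarrow> U \<subseteq> f ` topspace X \<and> openin X {x \<in> topspace X. f x \<in> U}" for U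
  have "istopology opn"
    unfolding istopology_def
  proof (intro conjI allI impI)
    fix S T assume "opn S" "opn T"
    then have "openin X ({x \<in> topspace X. f x \<in> S} \<inter> {x \<in> topspace X. f x \<in> T})"
      unfolding opn_def by (intro openin_Int) auto
    also have "{x \<in> topspace X. f x \<in> S} \<inter> {x \<in> topspace X. f x \<in> T} = {x \<in> topspace X. f x \<in> S \<inter> T}"
      by auto
    finally show "opn (S \<inter> T)" using \<open>opn S\<close> by (auto simp: opn_def)
  next
    fix \<K> assume K: "\<forall>K\<in>\<K>. opn K"
    then have "openin X (\<Union>K\<in>\<K>. {x \<in> topspace X. f x \<in> K})"
      by (auto simp: opn_def)
    also have "(\<Union>K\<in>\<K>. {x \<in> topspace X. f x \<in> K}) = {x \<in> topspace X. f x \<in> \<Union>\<K>}"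
      by auto
    finally show "opn (\<Union>\<K>)" using K by (auto simp: opn_def)
  qed
  then have op: "openin (topology opn) = opn" by (rule topology_inverse')
  have "{x \<in> topspace X. f x \<in> f ` topspace X} = topspace X" by auto
  then have "openin (topology opn) (f ` topspace X)" by (simp add: op opn_def)
  moreover have "topspace (topology opn) \<subseteq> f ` topspace X"
    using openin_topspace[of "topology opn"] by (simp add: op opn_def)
  ultimately have "topspace (topology opn) = f ` topspace X"
    by (simp add: openin_subset subset_antisym)
  then have "quotient_map X (topology opn) f"
    by (simp add: quotient_map_def op opn_def)
  then show ?thesis using that by blast
qed

text \<open>When the internal group is compact, it adds no room to be filled by the lattice: the graph of
  any homomorphism from a lattice \<open>L\<close> is discrete because \<open>L\<close> is, and cocompact because a ball
  that meets all cosets of \<open>L\<close>, times the internal group, meets all cosets of the graph.\<close>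

lemma cut_and_project_graph:
  fixes L :: "(real^'d) set" and H :: "'h monoid"
  assumes L: "lattice_in vec_group euclidean L"
    and H: "lca_group H X" "compact_space X"
    and hom: "\<iota> \<in> hom (vec_group\<lparr>carrier := L\<rparr>) H"
    and dense: "X closure_of (\<iota> ` L) = topspace X"
  shows "cut_and_project H X ((\<lambda>x. (x, \<iota> x)) ` L)"
proof -
  let ?E = "vec_group :: (real^'d) monoid"
  let ?P = "prod_topology (euclidean :: (real^'d) topology) X"
  let ?Lt = "(\<lambda>x. (x, \<iota> x)) ` L"
  interpret H: comm_group H using H(1) by (simp add: lca_group_def)
  interpret E: comm_group ?E by (rule comm_group_vec_group)
  have X: "topspace X = carrier H"
    using H(1) by (simp add: lca_group_def topological_group_def)
  have sub: "subgroup L ?E" using L by (simp add: lattice_in_def)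
  then have grpL: "group (?E\<lparr>carrier := L\<rparr>)"
    using subgroup.subgroup_is_group E.is_group by blast
  have grpEH: "group (?E \<times>\<times> H)" by (simp add: DirProd_group)
  have \<iota>: "\<iota> x \<in> carrier H" if "x \<in> L" for x
    using hom that by (auto simp: hom_def)
  have "(\<lambda>x. (x, \<iota> x)) \<in> hom (?E\<lparr>carrier := L\<rparr>) (?E \<times>\<times> H)"
    using hom by (auto simp: hom_def DirProd_def)
  then have "group_hom (?E\<lparr>carrier := L\<rparr>) (?E \<times>\<times> H) (\<lambda>x. (x, \<iota> x))"
    using grpL grpEH by (simp add: group_hom_def group_hom_axioms_def)
  then have subLt: "subgroup ?Lt (?E \<times>\<times> H)"
    using group_hom.img_is_subgroup[of "?E\<lparr>carrier := L\<rparr>" "?E \<times>\<times> H" "\<lambda>x. (x, \<iota> x)"] by simp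
  obtain e where e: "e > 0" "\<And>x y. x \<in> L \<Longrightarrow> y \<in> L \<Longrightarrow> dist x y < e \<Longrightarrow> x = y"
    by (rule lattice_discrete[OF L]) blast
  have "discrete_topology ?Lt = subtopology ?P ?Lt"
    unfolding discrete_topology_unique
  proof (intro conjI ballI)
    show "topspace (subtopology ?P ?Lt) = ?Lt" using \<iota> X by auto
    fix z assume "z \<in> ?Lt"
    then obtain x where x: "x \<in> L" "z = (x, \<iota> x)" by auto
    have "openin ?P (ball x e \<times> topspace X)" by (simp add: openin_prod_Times_iff)
    moreover have "{z} = (ball x e \<times> topspace X) \<inter> ?Lt"
    proof (intro subset_antisym subsetI)
      show "w \<in> (ball x e \<times> topspace X) \<inter> ?Lt" if "w \<in> {z}" for w
        using that x e(1) \<iota>[OF x(1)] by (simp add: X)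
      fix w assume "w \<in> (ball x e \<times> topspace X) \<inter> ?Lt"
      then obtain y where "y \<in> L" "w = (y, \<iota> y)" "y \<in> ball x e" by blast
      with x(2) e(2)[OF x(1), of y] show "w \<in> {z}" by simp
    qed
    ultimately show "openin (subtopology ?P ?Lt) {z}"
      unfolding openin_subtopology by blast
  qed
  moreover obtain Y where Y: "quotient_map ?P Y (\<lambda>z. ?Lt #>\<^bsub>?E \<times>\<times> H\<^esub> z)"
    using quotient_topology_exists .
  have "compact_space Y"
  proof -
    obtain R where R: "R > 0" "\<And>x. \<exists>l\<in>L. norm (x - l) \<le> R"
      by (rule lattice_cocompact[OF L]) blast
    let ?q = "\<lambda>z. ?Lt #>\<^bsub>?E \<times>\<times> H\<^esub> z"
    have covered: "\<exists>w\<in>cball 0 R \<times> topspace X. ?q z = ?q w" if zP: "z \<in> topspace ?P" for z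
    proof -
      obtain x h where z: "z = (x, h)" "h \<in> carrier H" using zP X by auto
      obtain l where l: "l \<in> L" "norm (x - l) \<le> R" using R(2) by blast
      let ?w = "(x - l, inv\<^bsub>H\<^esub> (\<iota> l) \<otimes>\<^bsub>H\<^esub> h)"
      have w: "?w \<in> cball 0 R \<times> topspace X"
        using l z \<iota>[OF l(1)] by (simp add: X)
      \<comment> \<open>Subtracting the lattice point over \<open>l\<close> moves \<open>z\<close> into the ball times the internal group.\<close>
      have z_eq: "z = (l, \<iota> l) \<otimes>\<^bsub>?E \<times>\<times> H\<^esub> ?w"
        using z \<iota>[OF l(1)] by (simp add: H.m_assoc[symmetric])
      have lLt: "(l, \<iota> l) \<in> ?Lt" using l by simp
      have wc: "?w \<in> carrier (?E \<times>\<times> H)" using w X by simp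
      have lc: "(l, \<iota> l) \<in> carrier (?E \<times>\<times> H)" using \<iota>[OF l(1)] by simp
      have "?q z = ?q (l, \<iota> l) #>\<^bsub>?E \<times>\<times> H\<^esub> ?w"
        unfolding z_eq by (rule group.coset_mult_assoc[OF grpEH subgroup.subset[OF subLt] lc wc, symmetric])
      also have "?q (l, \<iota> l) = ?Lt"
        by (rule group.coset_join2[OF grpEH lc subLt lLt])
      finally have "?q z = ?q ?w" .
      with w show ?thesis by blast
    qed
    have surj: "topspace Y = ?q ` topspace ?P"
      using Y by (simp only: quotient_map_def)
    have "topspace Y \<subseteq> ?q ` (cball 0 R \<times> topspace X)"
    proof
      fix y assume "y \<in> topspace Y"
      then obtain z where z: "y = ?q z" "z \<in> topspace ?P" unfolding surj by (rule imageE)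
      obtain w where w: "w \<in> cball 0 R \<times> topspace X" "?q z = ?q w"
        using covered[OF z(2)] by (rule bexE)
      show "y \<in> ?q ` (cball 0 R \<times> topspace X)"
        unfolding z(1) w(2) using w(1) by (rule imageI)
    qed
    moreover have "?q ` (cball 0 R \<times> topspace X) \<subseteq> topspace Y"
      unfolding surj by (intro image_mono) auto
    moreover have "compactin Y (?q ` (cball 0 R \<times> topspace X))"
    proof (rule image_compactin)
      show "compactin ?P (cball 0 R \<times> topspace X)"
        using H(2) by (simp add: compactin_Times compact_space_def)
      show "continuous_map ?P Y ?q" using Y quotient_imp_continuous_map by blast
    qed
    ultimately show ?thesis unfolding compact_space_def by (metis subset_antisym)
  qed
  ultimately have "lattice_in (?E \<times>\<times> H) ?P ?Lt"
    using subLt Y by (auto simp: lattice_in_def)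
  moreover have "inj_on fst ?Lt" by (auto simp: inj_on_def)
  moreover have "snd ` ?Lt = \<iota> ` L" by force
  ultimately show ?thesis
    using H(1) dense by (simp add: cut_and_project_def)
qed


section \<open>Lattice subsets containing a coset\<close>

text \<open>The window consists of the image of \<open>S\<close> in the profinite completion of \<open>L\<close>, which alone may
  have empty interior, and of the open set of all elements congruent to \<open>b\<close> modulo \<open>n L\<close>, whose
  points coming from \<open>L\<close> already belong to \<open>S\<close>.\<close>

lemma model_set_if_contains_coset:
  fixes L :: "(real^'d) set"
  assumes L: "lattice_in vec_group euclidean L" and S: "S \<subseteq> L"
    and n: "n > 0" and b: "\<And>x. x \<in> L \<Longrightarrow> b + real n *\<^sub>R x \<in> S"
  shows "model_set S"
proof -
  let ?E = "vec_group :: (real^'d) monoid"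
  interpret E: comm_group ?E by (rule comm_group_vec_group)
  have sub: "subgroup L ?E" using L by (simp add: lattice_in_def)
  then have L0: "0 \<in> L" "\<And>x y. x \<in> L \<Longrightarrow> y \<in> L \<Longrightarrow> x - y \<in> L"
    by (auto simp: subgroup_vec_group_iff)
  define G where "G = ?E\<lparr>carrier := L\<rparr>"
  interpret G: comm_group G
    unfolding G_def
    by (rule group.group_comm_groupI[OF subgroup.subgroup_is_group[OF sub E.is_group]]) (simp add: add.commute)
  have Gs [simp]: "carrier G = L" "x \<otimes>\<^bsub>G\<^esub> y = x + y" "\<one>\<^bsub>G\<^esub> = 0" for x y
    by (simp_all add: G_def)
  \<comment> \<open>The index is shifted to avoid the trivial subgroup \<open>0 L\<close>, which has infinite index.\<close>
  define N where "N k = (\<lambda>x. real (Suc k) *\<^sub>R x) ` L" for k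
  have N_sub: "subgroup (N k) ?E" for k
    unfolding subgroup_vec_group_iff N_def using L0 by (force simp flip: scaleR_diff_right)
  have mult_L: "real m *\<^sub>R x \<in> L" if "x \<in> L" for m x
    using subgroup_scaleR_nat[OF sub that] .
  have "subgroup (N k) G" for k
    unfolding G_def using N_sub[of k] sub mult_L[of _ "Suc k"]
    by (intro E.subgroup_incl) (auto simp: N_def simp del: of_nat_Suc)
  then have N: "N k \<lhd> G" for k
    by (rule G.subgroup_imp_normal)
  have coset: "N k #>\<^bsub>G\<^esub> x = (\<lambda>l. l + x) ` N k" for k x
    by (auto simp: r_coset_def)
  have coset_eqD: "x - y \<in> N k" if "N k #>\<^bsub>G\<^esub> x = N k #>\<^bsub>G\<^esub> y" for k x y
  proof -
    have "0 \<in> N k" using N_sub[of k] by (simp add: subgroup_vec_group_iff)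
    then have "x \<in> (\<lambda>l. l + y) ` N k" using that unfolding coset by force
    then show ?thesis by auto
  qed
  obtain R where R: "\<And>x. \<exists>l\<in>L. norm (x - l) \<le> R"
    by (rule lattice_cocompact[OF L]) blast
  have fin: "finite (carrier (G Mod N k))" for k
  proof -
    \<comment> \<open>Scaling by \<open>k + 1\<close>, every coset of \<open>(k + 1) L\<close> has a representative of norm at most
      \<open>(k + 1) R\<close>.\<close>
    have "N k #>\<^bsub>G\<^esub> x \<in> (\<lambda>c. N k #>\<^bsub>G\<^esub> c) ` (L \<inter> cball 0 (real (Suc k) * R))" if x: "x \<in> L" for x
    proof -
      obtain l where l: "l \<in> L" "norm (x /\<^sub>R real (Suc k) - l) \<le> R" using R by blast
      define c where "c = x - real (Suc k) *\<^sub>R l"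
      have "c = real (Suc k) *\<^sub>R (x /\<^sub>R real (Suc k) - l)"
        by (simp add: c_def scaleR_diff_right del: of_nat_Suc)
      then have "norm c \<le> real (Suc k) * R"
        using l(2) by (simp add: mult_left_mono del: of_nat_Suc)
      moreover have "c \<in> L" unfolding c_def using x l mult_L L0 by blast
      moreover have "N k #>\<^bsub>G\<^esub> x = N k #>\<^bsub>G\<^esub> c"
      proof -
        have nl: "real (Suc k) *\<^sub>R l \<in> N k" using l by (simp add: N_def)
        have Nk: "subgroup (N k) G" using N[of k] by (rule normal_imp_subgroup)
        have nlG: "real (Suc k) *\<^sub>R l \<in> carrier G" unfolding Gs by (rule mult_L[OF l(1)])
        have x_eq: "x = (real (Suc k) *\<^sub>R l) \<otimes>\<^bsub>G\<^esub> c" by (simp add: c_def)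
        have "N k #>\<^bsub>G\<^esub> x = (N k #>\<^bsub>G\<^esub> (real (Suc k) *\<^sub>R l)) #>\<^bsub>G\<^esub> c"
          unfolding x_eq using \<open>c \<in> L\<close>
          by (intro G.coset_mult_assoc[symmetric] subgroup.subset[OF Nk] nlG) simp
        also have "N k #>\<^bsub>G\<^esub> (real (Suc k) *\<^sub>R l) = N k"
          using nlG Nk nl by (rule G.coset_join2)
        finally show ?thesis .
      qed
      ultimately show ?thesis by (intro image_eqI[of _ _ c]) auto
    qed
    then have "carrier (G Mod N k) \<subseteq> (\<lambda>c. N k #>\<^bsub>G\<^esub> c) ` (L \<inter> cball 0 (real (Suc k) * R))"
      by (auto simp: carrier_FactGroup)
    then show ?thesis
      using finite_subset lattice_finite_cball[OF L] by blast
  qed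
  have comm: "comm_group (G Mod N k)" for k
    using N[of k] G.abelian_FactGroup normal_imp_subgroup by blast
  then have grp: "group (G Mod N k)" for k by (simp add: comm_group_def)

  define P where "P = product_group UNIV (\<lambda>k. G Mod N k)"
  define T where "T = product_topology (\<lambda>k. discrete_topology (carrier (G Mod N k))) UNIV"
  have P: "topological_group P T"
    unfolding P_def T_def by (intro topological_group_product topological_group_discrete grp)
  have P_comm: "x \<otimes>\<^bsub>P\<^esub> y = y \<otimes>\<^bsub>P\<^esub> x" if "x \<in> carrier P" "y \<in> carrier P" for x y
  proof -
    have "x k \<otimes>\<^bsub>G Mod N k\<^esub> y k = y k \<otimes>\<^bsub>G Mod N k\<^esub> x k" for k
      using that by (intro comm_groupE(4)[OF comm]) (auto simp: P_def PiE_iff)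
    then show ?thesis by (simp add: P_def)
  qed
  define \<iota> where "\<iota> x = (\<lambda>k. N k #>\<^bsub>G\<^esub> x)" for x
  have \<iota>_hom: "\<iota> \<in> hom G P"
    unfolding hom_def
  proof (intro CollectI conjI ballI funcsetI)
    show "\<iota> x \<in> carrier P" if "x \<in> carrier G" for x
      using that by (auto simp: \<iota>_def P_def carrier_FactGroup)
    show "\<iota> (x \<otimes>\<^bsub>G\<^esub> y) = \<iota> x \<otimes>\<^bsub>P\<^esub> \<iota> y" if "x \<in> carrier G" "y \<in> carrier G" for x y
      using that normal.r_coset_hom_Mod[OF N] by (auto simp: \<iota>_def P_def hom_def)
  qed
  have \<iota>_inj: "inj_on \<iota> L"
  proof
    fix x y assume xy: "x \<in> L" "y \<in> L" "\<iota> x = \<iota> y"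
    obtain e where e: "e > 0" "\<And>x y. x \<in> L \<Longrightarrow> y \<in> L \<Longrightarrow> dist x y < e \<Longrightarrow> x = y"
      by (rule lattice_discrete[OF L]) blast
    \<comment> \<open>A nonzero element of \<open>(k + 1) L\<close> has norm at least \<open>(k + 1) e\<close>.\<close>
    obtain k where k: "norm (x - y) / e < real k" using reals_Archimedean2 by blast
    have "x - y \<in> N k" using xy(3) by (intro coset_eqD) (simp add: \<iota>_def fun_eq_iff)
    then obtain l where l: "l \<in> L" "x - y = real (Suc k) *\<^sub>R l" by (auto simp: N_def)
    have "real (Suc k) * norm l = norm (x - y)" by (simp add: l(2))
    also have "\<dots> < real (Suc k) * e"
      using k e(1) by (simp add: field_simps)
    finally have "norm l < e" by (simp add: mult_less_cancel_left_pos del: of_nat_Suc)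
    then have "l = 0" using e(2)[OF l(1) L0(1)] by simp
    then show "x = y" using l(2) by simp
  qed

  define C where "C = T closure_of (\<iota> ` L)"
  define K where "K = P\<lparr>carrier := C\<rparr>"
  define X where "X = subtopology T C"
  have topT: "topspace T = carrier P" using P by (simp add: topological_group_def)
  have "group_hom G P \<iota>"
    using \<iota>_hom P G.is_group by (simp add: group_hom_def group_hom_axioms_def topological_group_def)
  then have "subgroup (\<iota> ` L) P"
    using group_hom.img_is_subgroup[of G P \<iota>] by simp
  then have C: "subgroup C P" "\<iota> ` L \<subseteq> C"
    unfolding C_def using subgroup_closure_of[OF P] closure_of_subset[of "\<iota> ` L" T] topT subgroup.subset
    by blast+
  have topK: "topological_group K X"
    unfolding K_def X_def by (rule topological_group_subgroup[OF P C(1)])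
  have topX: "topspace X = C"
    using topK by (simp add: topological_group_def K_def)
  have "comm_group K"
    using topK P_comm subgroup.subset[OF C(1)]
    by (intro group.group_comm_groupI) (auto simp: topological_group_def K_def)
  have "compact_space T"
    unfolding T_def by (simp add: compact_space_product_topology compact_space_discrete_topology fin)
  then have compX: "compact_space X"
    unfolding X_def C_def by (intro compact_space_subtopology closedin_compact_space) auto
  have "Hausdorff_space X"
    unfolding X_def T_def by (intro Hausdorff_space_subtopology) (simp add: Hausdorff_space_product_topology)
  then have lcaK: "lca_group K X"
    using \<open>comm_group K\<close> topK compX by (simp add: lca_group_def compact_imp_locally_compact_space)
  have denseX: "X closure_of (\<iota> ` L) = topspace X"
    unfolding topX using C(2) by (simp add: X_def closure_of_subtopology C_def Int_absorb1)

  obtain j :: "(nat \<Rightarrow> (real^'d) set) \<Rightarrow> (real^'d) set set" where j: "inj_on j C"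
    using inj_on_neighbourhood_traces[OF \<open>Hausdorff_space X\<close> denseX] topX by auto
  then obtain H :: "(real^'d) set set monoid" and Y
    where H: "lca_group H Y" "j \<in> iso K H" "homeomorphic_map X Y j"
    using lca_group_copy[OF lcaK, of j] by (auto simp: K_def)
  have compY: "compact_space Y"
    using H(3) compX homeomorphic_compact_space homeomorphic_map_imp_homeomorphic_space by blast
  have topY: "topspace Y = carrier H" "carrier H = j ` C"
    using H by (auto simp: lca_group_def topological_group_def iso_def bij_betw_def K_def)
  have hom: "j \<circ> \<iota> \<in> hom G H"
  proof (rule hom_compose)
    show "\<iota> \<in> hom G K" using \<iota>_hom C(2) by (auto simp: hom_def K_def)
    show "j \<in> hom K H" using H(2) by (simp add: iso_def)
  qed
  have dense: "Y closure_of ((j \<circ> \<iota>) ` L) = topspace Y"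
    using homeomorphic_map_closure_of[OF H(3), of "\<iota> ` L"] C(2) denseX topX topY
    by (simp add: image_comp)
  define Lt where "Lt = (\<lambda>x. (x, (j \<circ> \<iota>) x)) ` L"
  have cps: "cut_and_project H Y Lt"
    unfolding Lt_def using cut_and_project_graph[OF L H(1) compY hom[unfolded G_def] dense] .

  define W where "W = {h \<in> C. h (n - 1) = N (n - 1) #>\<^bsub>G\<^esub> b}"
  define \<Omega> where "\<Omega> = (j \<circ> \<iota>) ` S \<union> j ` W"
  have bL: "b \<in> S" using b[OF L0(1)] by simp
  have W_trace: "x \<in> S" if "x \<in> L" "\<iota> x \<in> W" for x
  proof -
    have "x - b \<in> N (n - 1)" using that by (intro coset_eqD) (simp add: W_def \<iota>_def)
    then obtain l where "l \<in> L" "x - b = real n *\<^sub>R l" using n by (auto simp: N_def)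
    then show ?thesis using b[of l] by (metis add.commute diff_add_cancel)
  qed
  have "openin X W"
  proof -
    have "continuous_map T (discrete_topology (carrier (G Mod N (n - 1)))) (\<lambda>h. h (n - 1))"
      unfolding T_def by (rule continuous_map_product_projection) simp
    then have "openin T {h \<in> topspace T. h (n - 1) \<in> {N (n - 1) #>\<^bsub>G\<^esub> b}}"
      using bL S by (intro openin_continuous_map_preimage) (auto simp: carrier_FactGroup)
    moreover have "W = {h \<in> topspace T. h (n - 1) \<in> {N (n - 1) #>\<^bsub>G\<^esub> b}} \<inter> C"
      using subgroup.subset[OF C(1)] topT by (auto simp: W_def)
    ultimately show ?thesis unfolding X_def openin_subtopology by blast
  qed
  then have "openin Y (j ` W)"
    using H(3) homeomorphic_map_openness_eq by blast
  then have "j ` W \<subseteq> Y interior_of \<Omega>"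
    by (intro interior_of_maximal) (auto simp: \<Omega>_def)
  moreover have "\<iota> b \<in> W" using bL S C(2) by (auto simp: W_def \<iota>_def)
  ultimately have int: "Y interior_of \<Omega> \<noteq> {}" by blast
  have "\<Omega> \<subseteq> carrier H"
    using C(2) S by (auto simp: \<Omega>_def topY W_def)
  moreover have "compactin Y (Y closure_of \<Omega>)"
    by (rule closedin_compact_space[OF compY closedin_closure_of])
  moreover have "Lambda Lt \<Omega> = S"
  proof
    show "S \<subseteq> Lambda Lt \<Omega>"
      using S by (force simp: Lambda_def Lt_def \<Omega>_def)
    show "Lambda Lt \<Omega> \<subseteq> S"
    proof
      fix x assume "x \<in> Lambda Lt \<Omega>"
      then have x: "x \<in> L" "j (\<iota> x) \<in> \<Omega>" by (auto simp: Lambda_def Lt_def)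
      then obtain h where h: "h \<in> \<iota> ` S \<union> W" "j (\<iota> x) = j h" by (auto simp: \<Omega>_def)
      have "h \<in> C" using h(1) C(2) S by (auto simp: W_def)
      then have "\<iota> x = h" using inj_onD[OF j, OF h(2)] x(1) C(2) by blast
      with h(1) consider y where "y \<in> S" "\<iota> x = \<iota> y" | "\<iota> x \<in> W" by blast
      then show "x \<in> S"
      proof cases
        case 1
        then have "x = y" using inj_onD[OF \<iota>_inj, OF \<open>\<iota> x = \<iota> y\<close> x(1)] S by blast
        then show ?thesis using \<open>y \<in> S\<close> by simp
      qed (rule W_trace[OF x(1)])
    qed
  qed
  then have "S = (\<lambda>y. 0 + y) ` Lambda Lt \<Omega>" by simp
  ultimately show ?thesis
    unfolding model_set_def using cps int by blast
qed

section \<open>Cosets in lattice substitution systems\<close>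

text \<open>Among the multiples \<open>0, x, \<dots>, m x\<close>, where \<open>m = card C\<close>, two lie in the same coset, so
  \<open>d x \<in> S\<close> for some \<open>d\<close> between \<open>1\<close> and \<open>m\<close>. All these \<open>d\<close> divide \<open>m!\<close>.\<close>

lemma multiple_in_subgroup_if_finite_cosets:
  fixes L S :: "(real^'d) set"
  assumes L: "subgroup L vec_group" and S: "subgroup S vec_group"
    and C: "finite C" "L \<subseteq> (\<Union>c\<in>C. (\<lambda>s. s + c) ` S)"
  obtains n where "n > 0" "\<And>x. x \<in> L \<Longrightarrow> real n *\<^sub>R x \<in> S"
proof
  show "fact (card C) > (0::nat)" by simp
  fix x assume x: "x \<in> L"
  have "\<exists>c\<in>C. real k *\<^sub>R x - c \<in> S" for k
  proof -
    have "real k *\<^sub>R x \<in> (\<Union>c\<in>C. (\<lambda>s. s + c) ` S)"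
      using C(2) subgroup_scaleR_nat[OF L x] by blast
    then show ?thesis by (auto intro!: bexI)
  qed
  then obtain c where c: "\<And>k. c k \<in> C" "\<And>k. real k *\<^sub>R x - c k \<in> S" by metis
  have "card (c ` {..card C}) < card {..card C}"
    using card_mono[OF C(1), of "c ` {..card C}"] c(1) by (auto simp: less_Suc_eq_le)
  then have "\<not> inj_on c {..card C}" using pigeonhole by blast
  then obtain i k where ik: "i < k" "k \<le> card C" "c i = c k"
    unfolding inj_on_def by (metis atMost_iff linorder_neqE_nat)
  have "(real k *\<^sub>R x - c k) - (real i *\<^sub>R x - c i) \<in> S"
    using S c(2) by (auto simp: subgroup_vec_group_iff)
  then have "real (k - i) *\<^sub>R x \<in> S" using ik by (simp add: of_nat_diff algebra_simps)
  moreover have "k - i dvd fact (card C)" using ik by (intro dvd_fact) auto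
  then obtain q where "fact (card C) = q * (k - i)" by (metis dvd_def mult.commute)
  ultimately show "real (fact (card C)) *\<^sub>R x \<in> S"
    using subgroup_scaleR_nat[OF S, of "real (k - i) *\<^sub>R x" q] by simp
qed

lemma subgroup_L_comp: "subgroup (L_comp V i) vec_group"
  unfolding subgroup_vec_group_iff L_comp_def by (auto intro: group_closure.diff)

lemma subgroup_L_sum: "subgroup (L_sum V) vec_group"
  unfolding subgroup_vec_group_iff
proof (intro conjI ballI)
  have L: "0 \<in> L_comp V i" "x \<in> L_comp V i \<Longrightarrow> y \<in> L_comp V i \<Longrightarrow> x - y \<in> L_comp V i" for i x y
    using subgroup_L_comp[of V i] by (auto simp: subgroup_vec_group_iff)
  show "0 \<in> L_sum V"
    unfolding L_sum_def using L(1) by (auto intro!: exI[of _ "\<lambda>_. 0"])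
  fix x y assume "x \<in> L_sum V" "y \<in> L_sum V"
  then obtain g h where "x = (\<Sum>i\<in>UNIV. g i)" "y = (\<Sum>i\<in>UNIV. h i)"
    "\<forall>i. g i \<in> L_comp V i" "\<forall>i. h i \<in> L_comp V i"
    by (auto simp: L_sum_def)
  then show "x - y \<in> L_sum V"
    unfolding L_sum_def using L(2) by (auto intro!: exI[of _ "\<lambda>i. g i - h i"] simp: sum_subtractf)
qed

lemma L_comp_subset_L_sum: "L_comp V i \<subseteq> L_sum V"
proof
  fix x assume x: "x \<in> L_comp V i"
  have "0 \<in> L_comp V k" for k using subgroup_L_comp[of V k] by (simp add: subgroup_vec_group_iff)
  with x show "x \<in> L_sum V"
    unfolding L_sum_def by (auto intro!: exI[of _ "\<lambda>k. if k = i then x else 0"])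
qed

lemma L_sum_subset:
  assumes L: "subgroup L vec_group" and V: "\<And>i. V i \<subseteq> L"
  shows "L_sum V \<subseteq> L"
proof -
  have L': "0 \<in> L" "\<And>x y. x \<in> L \<Longrightarrow> y \<in> L \<Longrightarrow> x - y \<in> L"
    using L by (auto simp: subgroup_vec_group_iff)
  have "x \<in> L" if "x \<in> L_comp V i" for i x
    using that unfolding L_comp_def by induction (use V[of i] L' in auto)
  moreover have "sum g A \<in> L" if "\<forall>i. g i \<in> L" "finite A" for A :: "'b::finite set" and g
    using that(2,1) by induction (use L' subgroup.m_closed[OF L] in auto)
  ultimately have "sum g UNIV \<in> L" if "\<forall>i. g i \<in> L_comp V i" for g
    using that by (metis finite_class.finite_UNIV)
  then show ?thesis by (auto simp: L_sum_def)
qed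

lemma lss_image_subset:
  assumes "is_lss Q V \<Phi>" "f \<in> \<Phi> i j" "x \<in> V j"
  shows "f x \<in> V i"
proof -
  have "V i = mfs_apply \<Phi> V i" using assms(1) by (simp add: is_lss_def)
  then show ?thesis using assms(2,3) by (auto simp: mfs_apply_def)
qed

text \<open>A positive entry \<open>(i, j)\<close> of the \<open>k\<close>-th power of the substitution matrix stands for a
  composition of \<open>k\<close> maps of \<open>\<Phi>\<close> that leads from type \<open>j\<close> to type \<open>i\<close>.\<close>

lemma subst_matrix_power_pos_imp_copy:
  assumes lss: "is_lss Q V \<Phi>" and pos: "0 < (((**) (subst_matrix \<Phi>) ^^ k) (mat 1)) $ i $ j"
  shows "\<exists>b. \<forall>x\<in>V j. (Q ^^ k) x + b \<in> V i"
  using pos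
proof (induction k arbitrary: i)
  case 0
  then have "i = j" by (auto simp: mat_def split: if_splits)
  then show ?case by (auto intro!: exI[of _ 0])
next
  case (Suc k)
  let ?S = "subst_matrix \<Phi>" and ?T = "((**) (subst_matrix \<Phi>) ^^ k) (mat 1)"
  have "(?S ** ?T) $ i $ j = (\<Sum>l\<in>UNIV. ?S $ i $ l * ?T $ l $ j)"
    unfolding matrix_matrix_mult_def[of ?S ?T] by simp
  moreover have "(?S ** ?T) $ i $ j \<noteq> 0"
    using Suc.prems by (simp only: funpow.simps o_apply neq0_conv)
  ultimately have "(\<Sum>l\<in>UNIV. ?S $ i $ l * ?T $ l $ j) \<noteq> 0"
    by (simp only: not_False_eq_True)
  then obtain l where l: "?S $ i $ l * ?T $ l $ j \<noteq> 0"
    by (meson sum.neutral)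
  then have "0 < ?T $ l $ j" by simp
  then obtain b where b: "\<forall>x\<in>V j. (Q ^^ k) x + b \<in> V l" using Suc.IH by blast
  have "card (\<Phi> i l) \<noteq> 0" using l by (simp add: subst_matrix_def)
  then obtain f where f: "f \<in> \<Phi> i l" by fastforce
  obtain a where a: "f = (\<lambda>x. Q x + a)" and lin: "linear Q"
    using lss f by (fastforce simp: is_lss_def is_mfs_def expansive_def)
  have "(Q ^^ Suc k) x + (Q b + a) \<in> V i" if "x \<in> V j" for x
    using lss_image_subset[OF lss f b[rule_format, OF that]] by (simp add: a linear_add[OF lin] add.assoc)
  then show ?case by blast
qed

text \<open>Every point of \<open>L\<close> lies in \<open>f (V j)\<close> for one of the finitely many maps \<open>f\<close>, hence in the
  coset of \<open>Q L\<close> given by the translational part \<open>f 0\<close>.\<close>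

lemma lss_multiple_in_image:
  fixes Q :: "real^'d \<Rightarrow> real^'d"
  assumes lss: "is_lss Q V \<Phi>"
  obtains n where "n > 0" "\<And>x. x \<in> supp V \<Longrightarrow> real n *\<^sub>R x \<in> Q ` supp V"
proof -
  have lin: "linear Q" and fin: "\<And>i j. finite (\<Phi> i j)"
    and form: "\<And>i j f. f \<in> \<Phi> i j \<Longrightarrow> \<exists>a. f = (\<lambda>x. Q x + a)"
    and L: "subgroup (supp V) vec_group" and V: "\<And>i. V i = mfs_apply \<Phi> V i"
    using lss by (auto simp: is_lss_def is_mfs_def expansive_def lattice_in_def)
  have QL: "subgroup (Q ` supp V) vec_group"
    unfolding subgroup_vec_group_iff
  proof (intro conjI ballI)
    show "0 \<in> Q ` supp V"
      using L linear_0[OF lin] by (force simp: subgroup_vec_group_iff)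
    show "x - y \<in> Q ` supp V" if "x \<in> Q ` supp V" "y \<in> Q ` supp V" for x y
      using that L by (auto simp: subgroup_vec_group_iff simp flip: linear_diff[OF lin])
  qed
  define C where "C = (\<Union>i j. (\<lambda>f. f 0) ` \<Phi> i j)"
  have "finite C" by (auto simp: C_def fin)
  moreover have "supp V \<subseteq> (\<Union>c\<in>C. (\<lambda>s. s + c) ` (Q ` supp V))"
  proof
    fix x assume "x \<in> supp V"
    then obtain i where "x \<in> mfs_apply \<Phi> V i" using V by (auto simp: supp_def)
    then obtain j f y where f: "f \<in> \<Phi> i j" "y \<in> V j" "x = f y"
      by (auto simp: mfs_apply_def)
    obtain a where a: "f = (\<lambda>x. Q x + a)" using form f(1) by blast
    have "a = f 0" by (simp add: a linear_0[OF lin])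
    then have "a \<in> C" using f(1) by (auto simp: C_def)
    moreover have "x = Q y + a" "y \<in> supp V" using f a by (auto simp: supp_def)
    ultimately show "x \<in> (\<Union>c\<in>C. (\<lambda>s. s + c) ` (Q ` supp V))" by blast
  qed
  ultimately show ?thesis
    using multiple_in_subgroup_if_finite_cosets[OF L QL] that by blast
qed

text \<open>Each \<open>V i\<close> lies in a single coset of \<open>L_comp V i\<close>, hence of \<open>L_sum V\<close>.\<close>

lemma lss_multiple_in_L_sum:
  fixes Q :: "real^'d \<Rightarrow> real^'d"
  assumes lss: "is_lss Q V \<Phi>"
  obtains n where "n > 0" "\<And>x. x \<in> supp V \<Longrightarrow> real n *\<^sub>R x \<in> L_sum V"
proof -
  have L: "subgroup (supp V) vec_group"
    using lss by (auto simp: is_lss_def lattice_in_def)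
  define C where "C = range (\<lambda>i. SOME v. v \<in> V i)"
  have "supp V \<subseteq> (\<Union>c\<in>C. (\<lambda>s. s + c) ` L_sum V)"
  proof
    fix x assume "x \<in> supp V"
    then obtain i where x: "x \<in> V i" by (auto simp: supp_def)
    define v where "v = (SOME v. v \<in> V i)"
    have "v \<in> V i" unfolding v_def using x by (rule someI)
    then have "x - v \<in> L_comp V i"
      using x unfolding L_comp_def by (auto intro!: group_closure.base)
    then have "x - v \<in> L_sum V" using L_comp_subset_L_sum by blast
    moreover have "v \<in> C" by (auto simp: C_def v_def)
    ultimately show "x \<in> (\<Union>c\<in>C. (\<lambda>s. s + c) ` L_sum V)" by force
  qed
  then show ?thesis
    using multiple_in_subgroup_if_finite_cosets[OF L subgroup_L_sum, of C V] that
    by (auto simp: C_def)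
qed

lemma linear_funpow:
  fixes Q :: "'a::real_vector \<Rightarrow> 'a"
  assumes "linear Q"
  shows "linear (Q ^^ k)"
proof (induction k)
  case (Suc k)
  then show ?case using linear_compose[OF Suc.IH assms] by (simp add: o_def)
qed (simp add: linear_iff)

theorem corollary4p6:
  fixes Q :: "real^'d \<Rightarrow> real^'d"
    and V :: "'m::finite \<Rightarrow> (real^'d) set"
    and \<Phi> :: "('m, 'd) mfs"
  assumes lss: "is_lss Q V \<Phi>"
    and primitive: "primitive_mfs \<Phi>"
    and standing: "clusters_generated V \<Phi>"
    and admissible: "admissible Q V \<Phi>"
    and singleton: "\<exists>a \<in> supp V. is_singleton (Psi0 V a)"
  shows "\<forall>i. model_set (V i)"
proof
  fix i
  have lat: "lattice_in vec_group euclidean (supp V)" and lin: "linear Q"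
    using lss by (auto simp: is_lss_def is_mfs_def expansive_def)
  then have L: "subgroup (supp V) vec_group" by (simp add: lattice_in_def)
  have V: "V i \<subseteq> supp V" for i by (auto simp: supp_def)
  obtain a i0 where a: "a \<in> supp V" "Psi0 V a = {i0}"
    using singleton by (auto elim: is_singletonE)
  \<comment> \<open>A point of \<open>a + L_sum V\<close> has some type, and \<open>i0\<close> is the only one possible.\<close>
  have coset: "a + y \<in> V i0" if "y \<in> L_sum V" for y
  proof -
    have "a + y \<in> supp V"
      using subgroup.m_closed[OF L a(1), of y] L_sum_subset[of "supp V" V, OF L V] that by auto
    then obtain i' where "a + y \<in> V i'" by (auto simp: supp_def)
    moreover from this that have "i' \<in> Psi0 V a" by (auto simp: Psi0_def)
    ultimately show ?thesis using a(2) by simp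
  qed
  obtain m where m: "m > 0" "\<And>x. x \<in> supp V \<Longrightarrow> real m *\<^sub>R x \<in> L_sum V"
    using lss_multiple_in_L_sum[OF lss] by blast
  obtain n where n: "n > 0" "\<And>x. x \<in> supp V \<Longrightarrow> real n *\<^sub>R x \<in> Q ` supp V"
    using lss_multiple_in_image[OF lss] by blast
  obtain k b where kb: "\<And>x. x \<in> V i0 \<Longrightarrow> (Q ^^ k) x + b \<in> V i"
    using primitive subst_matrix_power_pos_imp_copy[OF lss]
    unfolding primitive_mfs_def primitive_matrix_def by metis
  \<comment> \<open>Since \<open>n L \<subseteq> Q L\<close> and \<open>Q\<close> is linear, \<open>n\<^sup>r L \<subseteq> Q\<^sup>r L\<close>.\<close>
  have pow: "\<exists>y\<in>supp V. real (n ^ r) *\<^sub>R x = (Q ^^ r) y" if "x \<in> supp V" for r x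
    using that
  proof (induction r arbitrary: x)
    case (Suc r)
    obtain y where y: "y \<in> supp V" "real n *\<^sub>R x = Q y" using n(2)[OF Suc.prems] by auto
    obtain z where z: "z \<in> supp V" "real (n ^ r) *\<^sub>R y = (Q ^^ r) z" using Suc.IH[OF y(1)] by blast
    have "real (n ^ Suc r) *\<^sub>R x = real (n ^ r) *\<^sub>R Q y" by (simp add: mult.commute flip: y(2))
    also have "\<dots> = Q (real (n ^ r) *\<^sub>R y)" by (simp only: linear_cmul[OF lin])
    also have "\<dots> = (Q ^^ Suc r) z" by (simp only: z(2) funpow.simps o_apply)
    finally show ?case using z(1) by blast
  qed auto
  \<comment> \<open>The coset \<open>Q\<^sup>k (a + m L) + b\<close> lies in \<open>V i\<close>, and \<open>n\<^sup>k L \<subseteq> Q\<^sup>k L\<close>.\<close>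
  have "((Q ^^ k) a + b) + real (m * n ^ k) *\<^sub>R x \<in> V i" if x: "x \<in> supp V" for x
  proof -
    obtain y where y: "y \<in> supp V" "real (n ^ k) *\<^sub>R x = (Q ^^ k) y" using pow[OF x] by blast
    have "real (m * n ^ k) *\<^sub>R x = (Q ^^ k) (real m *\<^sub>R y)"
      using y(2) by (simp add: linear_cmul[OF linear_funpow[OF lin]] flip: scaleR_scaleR)
    moreover have "(Q ^^ k) (a + real m *\<^sub>R y) + b \<in> V i"
      using kb coset m(2) y(1) by blast
    ultimately show ?thesis
      by (simp add: linear_add[OF linear_funpow[OF lin]] algebra_simps)
  qed
  moreover have "m * n ^ k > 0" using m(1) n(1) by simp
  ultimately show "model_set (V i)"
    using model_set_if_contains_coset[OF lat V] by blast
qed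

end
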